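(* Let $(X,f)$ be a sensitive topologically transitive dynamical system, where $X$ is a (nonempty) compact metric space with metric $d$ and $f:X\to X$ is continuous. Then $\mathbb{L}_d=\overline{\mathbb{L}}_d$.
   Context: A topological dynamical system $(X,f)$ is a nonempty compact metric space $(X,d)$ together with a continuous map $f:X\to X$. "Opene" means open and nonempty. $(X,f)$ is sensitive if there exists $\varepsilon>0$ such that for every $x\in X$ and every neighborhood $U_x$ of $x$ there exist $y\in U_x$ and an integer $n\ge 0$ with $d(f^n(x),f^n(y))>\varepsilon$. $(X,f)$ is topologically transitive if for any pair of opene subsets $U,V\subset X$ the set $\{n\in\mathbb{Z}_+ : U\cap f^{-n}(V)\neq\varnothing\}$ is infinite. The Lyapunov numbers in the claim are (suprema over real numbers $\varepsilon$): $$\mathbb{L}_d=\sup\{\varepsilon:\ \text{in any opene } U\subset X \text{ there exist } x,y\in U \text{ and a positive integer } n \text{ with } d(f^n(x),f^n(y))>\varepsilon\},$$ $$\overline{\mathbb{L}}_d=\sup\{\varepsilon:\ \text{in any opene } U\subset X \text{ there exist } x,y\in U \text{ with } \limsup_{n\to\infty} d(f^n(x),f^n(y))>\varepsilon\}.$$ *)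

theory Defs
  imports "HOL-Analysis.Analysis"
begin

(* The compact metric space is a subset X of a metric space type, with the metric dist of
   that type.  Open subsets of X are relatively open, i.e. open in top_of_set X.  The map f
   is a total function on the type, of which only the restriction to X matters. *)

definition dynamical_system :: "'a::metric_space set \<Rightarrow> ('a \<Rightarrow> 'a) \<Rightarrow> bool" where
  "dynamical_system X f \<longleftrightarrow> X \<noteq> {} \<and> compact X \<and> continuous_on X f \<and> f ` X \<subseteq> X"

definition opene :: "'a::topological_space set \<Rightarrow> 'a set \<Rightarrow> bool" where
  "opene X U \<longleftrightarrow> openin (top_of_set X) U \<and> U \<noteq> {}"

definition sensitive :: "'a::metric_space set \<Rightarrow> ('a \<Rightarrow> 'a) \<Rightarrow> bool" where
  "sensitive X f \<longleftrightarrow>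
    (\<exists>\<epsilon>>0. \<forall>x\<in>X. \<forall>U. openin (top_of_set X) U \<and> x \<in> U \<longrightarrow>
      (\<exists>y\<in>U. \<exists>n. dist ((f ^^ n) x) ((f ^^ n) y) > \<epsilon>))"

definition topologically_transitive :: "'a::topological_space set \<Rightarrow> ('a \<Rightarrow> 'a) \<Rightarrow> bool" where
  "topologically_transitive X f \<longleftrightarrow>
    (\<forall>U V. opene X U \<and> opene X V \<longrightarrow> infinite {n. U \<inter> (f ^^ n) -` V \<noteq> {}})"

(* Both suprema are over real numbers of either sign.  For a dynamical system the sets contain
   every negative real and are bounded above by the diameter of X, so Sup on the reals is the
   true supremum. *)

definition lyapunov :: "'a::metric_space set \<Rightarrow> ('a \<Rightarrow> 'a) \<Rightarrow> real" where
  "lyapunov X f = Sup {\<epsilon>. \<forall>U. opene X U \<longrightarrow>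
     (\<exists>x\<in>U. \<exists>y\<in>U. \<exists>n>0. dist ((f ^^ n) x) ((f ^^ n) y) > \<epsilon>)}"

(* limsup needs a complete linear order, hence the embedding into the extended reals. *)
definition limsup_lyapunov :: "'a::metric_space set \<Rightarrow> ('a \<Rightarrow> 'a) \<Rightarrow> real" where
  "limsup_lyapunov X f = Sup {\<epsilon>. \<forall>U. opene X U \<longrightarrow>
     (\<exists>x\<in>U. \<exists>y\<in>U. limsup (\<lambda>n. ereal (dist ((f ^^ n) x) ((f ^^ n) y))) > ereal \<epsilon>)}"

end

theory Submission
  imports Defs
begin

text \<open>
  The two suprema are taken over the same set of thresholds.  The core is a stronger fact about a
  single opene set \<open>U\<close>: if some iterate \<open>f\<^sup>n\<close> separates two points of \<open>U\<close> by more
  than \<open>\<epsilon>\<close>, then some two points of \<open>U\<close> are separated by more than \<open>\<epsilon>\<close> infinitely often, with a limit superior above \<open>\<epsilon>\<close>.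

  By transitivity and the Baire category theorem there is a point \<open>x\<close> whose orbit visits every
  opene set infinitely often (\<open>transitive_imp_infinite_visits\<close>).  Separation by \<open>f\<^sup>n\<close> is an open
  condition, so the two given points of \<open>U\<close> may be replaced by points \<open>a\<close> and \<open>f\<^sup>k a\<close> of this
  single orbit.  Now the point \<open>z = f\<^sup>n a\<close> satisfies \<open>dist z (f\<^sup>k z) > \<epsilon>\<close>, because \<open>f\<^sup>n\<close> and
  \<open>f\<^sup>k\<close> commute.  The condition is open in \<open>z\<close>, hence the orbit of \<open>a\<close> returns
  to it infinitely often, and at each such time the iterates of \<open>a\<close> and \<open>f\<^sup>k a\<close> are more than \<open>\<epsilon>\<close>
  apart (\<open>separation_imp_limsup_separation\<close>).
\<close>

lemma funpow_in:
  assumes "f ` X \<subseteq> X" "x \<in> X"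
  shows "(f ^^ n) x \<in> X"
  using assms by (induction n) auto

lemma continuous_on_funpow:
  fixes f :: "'a::topological_space \<Rightarrow> 'a"
  assumes "continuous_on X f" "f ` X \<subseteq> X"
  shows "continuous_on X (f ^^ n)"
proof (induction n)
  case 0
  show ?case by (simp add: id_def)
next
  case (Suc n)
  have "(f ^^ n) ` X \<subseteq> X"
    using funpow_in[OF assms(2)] by blast
  then have "continuous_on X (f \<circ> (f ^^ n))"
    using Suc assms(1) continuous_on_compose continuous_on_subset by blast
  then show ?case by simp
qed

lemma openin_strict_superlevel:
  fixes g :: "'a::topological_space \<Rightarrow> real"
  assumes "continuous_on X g"
  shows "openin (top_of_set X) {x \<in> X. c < g x}"
proof -
  have "{x \<in> X. c < g x} = X \<inter> g -` {c<..}" by auto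
  then show ?thesis
    using continuous_openin_preimage_gen[OF assms, of "{c<..}"] by simp
qed

text \<open>Countability comes from total boundedness: the balls of radius \<open>1/(n+1)\<close> around a finite
  net, for all \<open>n\<close>, get inside every nonempty open set.\<close>

lemma compact_countable_opene_subbasis:
  fixes X :: "'a::metric_space set"
  assumes "compact X"
  obtains B where "countable B" "\<And>V. V \<in> B \<Longrightarrow> opene X V"
    "\<And>U. opene X U \<Longrightarrow> \<exists>V\<in>B. V \<subseteq> U"
proof -
  have "\<forall>e>0. \<exists>K. finite K \<and> K \<subseteq> X \<and> X \<subseteq> (\<Union>x\<in>K. ball x e)"
    using assms compact_imp_seq_compact seq_compact_imp_totally_bounded by blast
  then have "\<forall>n::nat. \<exists>K. finite K \<and> K \<subseteq> X \<and> X \<subseteq> (\<Union>x\<in>K. ball x (inverse (Suc n)))"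
    by simp
  then obtain K where K: "\<And>n::nat. finite (K n)" "\<And>n. K n \<subseteq> X"
      "\<And>n. X \<subseteq> (\<Union>x\<in>K n. ball x (inverse (Suc n)))"
    by metis
  define B where "B = (\<Union>n. (\<lambda>x. X \<inter> ball x (inverse (Suc n))) ` K n)"
  show ?thesis
  proof
    show "countable B"
      unfolding B_def using K(1) by (simp add: countable_finite)
  next
    fix V assume "V \<in> B"
    then obtain n x where "x \<in> K n" "V = X \<inter> ball x (inverse (Suc n))"
      unfolding B_def by auto
    then have "openin (top_of_set X) V" "x \<in> V"
      using K(2) by auto
    then show "opene X V" by (auto simp: opene_def)
  next
    fix U assume "opene X U"
    then obtain u where u: "u \<in> U" "openin (top_of_set X) U"
      unfolding opene_def by blast
    then obtain e where e: "e > 0" "X \<inter> ball u e \<subseteq> U" and "u \<in> X"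
      unfolding openin_contains_ball by blast
    obtain n :: nat where n: "inverse (Suc n) < e / 2"
      using reals_Archimedean[of "e / 2"] e(1) by auto
    obtain c where c: "c \<in> K n" "dist c u < inverse (Suc n)"
      using K(3)[of n] \<open>u \<in> X\<close> by auto
    have "ball c (inverse (Suc n)) \<subseteq> ball u e"
    proof
      fix y assume "y \<in> ball c (inverse (Suc n))"
      then show "y \<in> ball u e"
        using c(2) n dist_triangle3[of u y c] by simp
    qed
    moreover have "X \<inter> ball c (inverse (Suc n)) \<in> B"
      unfolding B_def using c(1) by blast
    ultimately show "\<exists>V\<in>B. V \<subseteq> U"
      using e(2) by (intro bexI[of _ "X \<inter> ball c (inverse (Suc n))"]) (auto simp del: mem_ball)
  qed
qed

text \<open>For a fixed opene set \<open>V\<close> and a fixed time \<open>N\<close>, the points visiting \<open>V\<close> at some time \<open>n \<ge> N\<close>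
  form an open set, which transitivity makes dense.  It suffices to let \<open>V\<close> range over a countable
  family inside every opene set, so Baire's theorem provides a common point.\<close>

lemma transitive_imp_infinite_visits:
  assumes ds: "dynamical_system X f" and tt: "topologically_transitive X f"
  obtains x where "x \<in> X" "\<And>V. opene X V \<Longrightarrow> \<exists>\<^sub>\<infinity>n. (f ^^ n) x \<in> V"
proof -
  have X: "X \<noteq> {}" "compact X" "continuous_on X f" "f ` X \<subseteq> X"
    using ds by (simp_all add: dynamical_system_def)
  obtain B where B: "countable B" "\<And>V. V \<in> B \<Longrightarrow> opene X V"
      "\<And>U. opene X U \<Longrightarrow> \<exists>V\<in>B. V \<subseteq> U"
    by (rule compact_countable_opene_subbasis[OF X(2)]) (rule that)
  define G where "G = (\<lambda>(V, N). \<Union>n\<in>{N::nat..}. X \<inter> (f ^^ n) -` V)"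
  have "top_of_set X closure_of \<Inter>(G ` (B \<times> UNIV)) = topspace (top_of_set X)"
  proof (rule Baire_category)
    have "compact_space (top_of_set X)"
      using X(2) by (intro compact_space_subtopology) simp
    moreover have "Hausdorff_space (top_of_set X)"
      by (simp add: Hausdorff_space_subtopology)
    ultimately show "completely_metrizable_space (top_of_set X)
        \<or> locally_compact_space (top_of_set X) \<and> regular_space (top_of_set X)"
      by (simp add: compact_imp_locally_compact_space compact_Hausdorff_imp_regular_space)
    show "countable (G ` (B \<times> UNIV))"
      using B(1) by simp
  next
    fix T assume "T \<in> G ` (B \<times> UNIV)"
    then obtain V N where V: "V \<in> B" and T: "T = (\<Union>n\<in>{N..}. X \<inter> (f ^^ n) -` V)"
      by (auto simp: G_def)
    have oV: "openin (top_of_set X) V"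
      using B(2)[OF V] by (simp add: opene_def)
    have "openin (top_of_set X) (X \<inter> (f ^^ n) -` V)" for n
    proof (rule continuous_openin_preimage[OF continuous_on_funpow[OF X(3,4)] _ oV])
      show "f ^^ n \<in> X \<rightarrow> X"
        using funpow_in[OF X(4)] by blast
    qed
    then have "openin (top_of_set X) T"
      unfolding T by blast
    moreover have "T \<inter> W \<noteq> {}" if "openin (top_of_set X) W" "W \<noteq> {}" for W
    proof -
      have "infinite {n. W \<inter> (f ^^ n) -` V \<noteq> {}}"
        using tt that B(2)[OF V] by (simp add: topologically_transitive_def opene_def)
      then obtain n where "n \<ge> N" "W \<inter> (f ^^ n) -` V \<noteq> {}"
        unfolding infinite_nat_iff_unbounded_le by blast
      moreover have "W \<subseteq> X"
        using that(1) openin_imp_subset by blast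
      ultimately show ?thesis unfolding T by auto
    qed
    ultimately show "openin (top_of_set X) T
        \<and> top_of_set X closure_of T = topspace (top_of_set X)"
      by (simp only: dense_intersects_open) blast
  qed
  then have "\<Inter>(G ` (B \<times> UNIV)) \<inter> X \<noteq> {}"
    using X(1) dense_intersects_open[of "top_of_set X"] by (metis openin_subtopology_self)
  then obtain x where x: "x \<in> X" "\<And>V N. V \<in> B \<Longrightarrow> x \<in> G (V, N)"
    by blast
  show ?thesis
  proof
    fix U assume "opene X U"
    then obtain V where V: "V \<in> B" "V \<subseteq> U" using B(3) by blast
    show "\<exists>\<^sub>\<infinity>n. (f ^^ n) x \<in> U"
      unfolding INFM_nat_le
    proof
      fix N
      show "\<exists>n\<ge>N. (f ^^ n) x \<in> U"
        using x(2)[OF V(1), of N] V(2) by (auto simp: G_def)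
    qed
  qed (fact x(1))
qed

text \<open>Two points of \<open>U\<close> separated once are traded for two points \<open>a\<close> and \<open>f\<^sup>k a\<close> on one orbit, which
  are separated every time that orbit meets the open set of points moved far by \<open>f\<^sup>k\<close>.\<close>

lemma separation_imp_limsup_separation:
  fixes X :: "'a::metric_space set"
  assumes ds: "dynamical_system X f" and tt: "topologically_transitive X f"
    and U: "opene X U" and y: "y \<in> U" "y' \<in> U"
    and sep: "dist ((f ^^ n) y) ((f ^^ n) y') > \<epsilon>"
  obtains a b where "a \<in> U" "b \<in> U"
    "limsup (\<lambda>m. ereal (dist ((f ^^ m) a) ((f ^^ m) b))) > ereal \<epsilon>"
proof -
  have X: "continuous_on X f" "f ` X \<subseteq> X"
    using ds by (simp_all add: dynamical_system_def)
  note cont = continuous_on_funpow[OF X]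
  obtain x where x: "x \<in> X" and inf_visits: "\<And>V. opene X V \<Longrightarrow> \<exists>\<^sub>\<infinity>n. (f ^^ n) x \<in> V"
    by (rule transitive_imp_infinite_visits[OF ds tt]) (rule that)
  have visit: "\<exists>n\<ge>N. (f ^^ n) x \<in> V" if "opene X V" for V N
    using inf_visits[OF that] by (simp add: INFM_nat_le)
  have UX: "openin (top_of_set X) U" "U \<subseteq> X"
    using U openin_imp_subset by (auto simp: opene_def)
  \<comment> \<open>The slack between \<open>\<epsilon>\<close> and \<open>\<epsilon>'\<close> keeps the limit superior strictly above \<open>\<epsilon>\<close>.\<close>
  obtain \<epsilon>' where \<epsilon>': "\<epsilon> < \<epsilon>'" "\<epsilon>' < dist ((f ^^ n) y) ((f ^^ n) y')"
    using sep dense by blast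
  \<comment> \<open>The orbit points are chosen one after the other: the second has to be far from the \<open>n\<close>-th
    iterate of the first, and its visiting time has to be the later one.\<close>
  define A where "A = U \<inter> {w \<in> X. \<epsilon>' < dist ((f ^^ n) w) ((f ^^ n) y')}"
  have "openin (top_of_set X) A"
    unfolding A_def
    by (intro openin_Int UX(1) openin_strict_superlevel continuous_intros cont)
  moreover have "y \<in> A" using y UX \<epsilon>' by (auto simp: A_def)
  ultimately have "opene X A" by (auto simp: opene_def)
  then obtain j where j: "(f ^^ j) x \<in> A"
    using visit by blast
  define a where "a = (f ^^ j) x"
  have a: "a \<in> U" "a \<in> X" "\<epsilon>' < dist ((f ^^ n) a) ((f ^^ n) y')"
    using j by (auto simp: a_def A_def)
  define A' where "A' = U \<inter> {w \<in> X. \<epsilon>' < dist ((f ^^ n) a) ((f ^^ n) w)}"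
  have "openin (top_of_set X) A'"
    unfolding A'_def
    by (intro openin_Int UX(1) openin_strict_superlevel continuous_intros cont)
  moreover have "y' \<in> A'" using y UX a by (auto simp: A'_def)
  ultimately have "opene X A'" by (auto simp: opene_def)
  then obtain i where i: "i \<ge> j" "(f ^^ i) x \<in> A'"
    using visit by blast
  define k where "k = i - j"
  have "(f ^^ i) x = (f ^^ k) a"
    using i(1) funpow_add[of k j f] by (simp add: a_def k_def)
  then have b: "(f ^^ k) a \<in> U" "\<epsilon>' < dist ((f ^^ n) a) ((f ^^ n) ((f ^^ k) a))"
    using i(2) by (auto simp: A'_def)
  have comm: "(f ^^ m) ((f ^^ k) z) = (f ^^ k) ((f ^^ m) z)" for m z
    by (metis add.commute comp_apply funpow_add)
  define W where "W = {z \<in> X. \<epsilon>' < dist z ((f ^^ k) z)}"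
  have "openin (top_of_set X) W"
    unfolding W_def by (intro openin_strict_superlevel continuous_intros cont)
  moreover have "(f ^^ n) a \<in> W"
    using b(2) funpow_in[OF X(2) a(2)] by (simp add: W_def comm)
  ultimately have oW: "opene X W" by (auto simp: opene_def)
  have *: "\<exists>m\<ge>N. \<epsilon>' < dist ((f ^^ m) a) ((f ^^ m) ((f ^^ k) a))" for N
  proof -
    obtain l where l: "l \<ge> N + j" "(f ^^ l) x \<in> W"
      using visit[OF oW] by blast
    have "(f ^^ l) x = (f ^^ (l - j)) a"
      using l(1) funpow_add[of "l - j" j f] by (simp add: a_def)
    then show ?thesis
      using l by (intro exI[of _ "l - j"]) (auto simp: W_def comm)
  qed
  have "ereal \<epsilon>' \<le> limsup (\<lambda>m. ereal (dist ((f ^^ m) a) ((f ^^ m) ((f ^^ k) a))))"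
  proof (rule ccontr)
    assume "\<not> ?thesis"
    then have "\<forall>\<^sub>F m in sequentially. ereal (dist ((f ^^ m) a) ((f ^^ m) ((f ^^ k) a))) < ereal \<epsilon>'"
      by (intro Limsup_lessD) simp
    then obtain N where "\<And>m. m \<ge> N \<Longrightarrow> dist ((f ^^ m) a) ((f ^^ m) ((f ^^ k) a)) < \<epsilon>'"
      unfolding eventually_sequentially by auto
    then show False using *[of N] by force
  qed
  moreover have "ereal \<epsilon> < ereal \<epsilon>'"
    using \<epsilon>'(1) by simp
  ultimately have "ereal \<epsilon> < limsup (\<lambda>m. ereal (dist ((f ^^ m) a) ((f ^^ m) ((f ^^ k) a))))"
    by (rule less_le_trans[rotated])
  then show ?thesis
    by (rule that[OF a(1) b(1)])
qed

lemma limsup_separation_imp_separation: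
  fixes g h :: "nat \<Rightarrow> 'a::metric_space"
  assumes "limsup (\<lambda>n. ereal (dist (g n) (h n))) > ereal \<epsilon>"
  shows "\<exists>n>0. dist (g n) (h n) > \<epsilon>"
proof (rule ccontr)
  assume never: "\<not> ?thesis"
  have "ereal (dist (g n) (h n)) \<le> ereal \<epsilon>" if "1 \<le> n" for n
  proof -
    have "\<not> dist (g n) (h n) > \<epsilon>"
      using never that by (metis less_le_trans zero_less_one)
    then show ?thesis by simp
  qed
  then have "\<forall>\<^sub>F n in sequentially. ereal (dist (g n) (h n)) \<le> ereal \<epsilon>"
    by (rule eventually_sequentiallyI)
  then have "limsup (\<lambda>n. ereal (dist (g n) (h n))) \<le> ereal \<epsilon>"
    by (rule Limsup_bounded)
  then show False using assms by simp
qed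

theorem theorem3p1:
  fixes X :: "'a::metric_space set" and f :: "'a \<Rightarrow> 'a"
  assumes "dynamical_system X f"
    and "sensitive X f"
    and "topologically_transitive X f"
  shows "lyapunov X f = limsup_lyapunov X f"
proof -
  have "(\<exists>x\<in>U. \<exists>y\<in>U. \<exists>n>0. dist ((f ^^ n) x) ((f ^^ n) y) > \<epsilon>) \<longleftrightarrow>
        (\<exists>x\<in>U. \<exists>y\<in>U. limsup (\<lambda>n. ereal (dist ((f ^^ n) x) ((f ^^ n) y))) > ereal \<epsilon>)"
    (is "?once \<longleftrightarrow> ?limsup") if "opene X U" for U \<epsilon>
  proof
    assume ?once
    then obtain x y n where "x \<in> U" "y \<in> U" "dist ((f ^^ n) x) ((f ^^ n) y) > \<epsilon>"
      by blast
    then show ?limsup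
      by (rule separation_imp_limsup_separation[OF assms(1,3) that]) blast
  next
    assume ?limsup
    then show ?once
      by (elim bexE) (intro bexI limsup_separation_imp_separation)
  qed
  then show ?thesis
    unfolding lyapunov_def limsup_lyapunov_def by (simp cong: imp_cong)
qed

end
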